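(* Let $A\subseteq\mathbb{N}$, and let $E=\mathbb{N}\setminus(A+A)$. If $$D(E)<\frac12,$$ then $$\limsup_{n\to\infty} r(n)>3.$$
   Context: $\mathbb{N}$ denotes the set of positive integers. For $A\subseteq\mathbb{N}$, $A+A=\{a+b: a,b\in A\}$ and $r(n)=\#\{(a,b)\in A\times A: a+b=n\}$ is the ordered representation function of $A$. For $E\subseteq\mathbb{N}$, the upper density is $D(E)=\limsup_{n\to\infty}\frac{|E\cap\{1,2,\ldots,n\}|}{n}$. The limsup of $r(n)$ is allowed to be $+\infty$. *)

theory Defs
  imports "HOL-Analysis.Analysis" "HOL-Library.Set_Algebras"
begin

definition rep :: "nat set \<Rightarrow> nat \<Rightarrow> nat" where
  "rep A n = card {(a, b) \<in> A \<times> A. a + b = n}"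

text \<open>The value at \<open>n = 0\<close> is a division by zero, which does not affect the limit superior.\<close>

definition upper_density :: "nat set \<Rightarrow> ereal" where
  "upper_density E = limsup (\<lambda>n. ereal (real (card (E \<inter> {1..n})) / real n))"

end

theory Submission
  imports Defs
begin

text \<open>
  An exceptional set of upper density below \<open>1\<close> forces a limit superior above \<open>3\<close>
  (\<open>limsup_rep_gt_3_if_upper_density_less_1\<close>), because a set with at most three
  representations of every large number is almost a Sidon set, and infinite Sidon sets are known
  to be thin along a subsequence (Erdos).

  Suppose \<open>rep A n \<le> 3\<close> for all large \<open>n\<close>. Dropping finitely many elements leaves a set \<open>B\<close> with
  \<open>rep B n \<le> 3\<close> everywhere. In \<open>B\<close>, every positive difference occurs at most twice, since two
  pairs with the same difference that do not overlap produce four representations of one number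
  (\<open>card_equal_differences\<close>). Cut \<open>{..<N * N}\<close> into \<open>N\<close> blocks of length \<open>N\<close> and let \<open>D l\<close> be the
  number of elements of \<open>B\<close> in the \<open>l\<close>-th block. Pairs inside one block have differences below
  \<open>N\<close>, so there are fewer than \<open>2 * N\<close> of them, and hence the sum of the squares of the
  \<open>D l\<close> is at most \<open>9 * N\<close> (\<open>sum_block_squares\<close>). By Cauchy-Schwarz, the sum of
  \<open>D l / sqrt (l + 1)\<close> is at most a constant times \<open>sqrt (N * H)\<close>, with \<open>H\<close> the \<open>N\<close>-th harmonic
  number.

  On the other hand, if \<open>A + A\<close> has positive lower density, then \<open>A\<close>, and so also \<open>B\<close>, has at
  least a constant times \<open>sqrt n\<close> elements below every large \<open>n\<close>. By partial summation the same
  weighted sum is then at least a constant times \<open>sqrt N * H\<close> (\<open>weighted_sum_lower_bound\<close>).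
  As \<open>H\<close> is unbounded, the two bounds contradict each other (\<open>rep_le_3_not_dense\<close>).
\<close>

section \<open>Differences in a set with few representations\<close>

lemma finite_rep: "finite {(a, b) \<in> A \<times> A. a + b = (n::nat)}"
  by (rule finite_subset[of _ "{..n} \<times> {..n}"]) auto

lemma rep_mono: "B \<subseteq> A \<Longrightarrow> rep B n \<le> rep A n"
  unfolding rep_def by (rule card_mono[OF finite_rep]) auto

text \<open>The number \<open>x + (y + d) = y + (x + d)\<close> has these two representations and their swaps; they
  coincide only when \<open>y = x + d\<close>.\<close>

lemma equal_differences_overlap:
  assumes "\<And>n. rep B n \<le> 3"
    and "x \<in> B" "x + d \<in> B" "y \<in> B" "y + d \<in> B" "x < y" "0 < d"
  shows "y = x + d"
proof (rule ccontr)
  assume "y \<noteq> x + d"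
  let ?F = "{(x, y + d), (y + d, x), (y, x + d), (x + d, y)}"
  have "card ?F = 4"
    using \<open>y \<noteq> x + d\<close> assms by auto
  moreover have "card ?F \<le> rep B (x + y + d)"
    unfolding rep_def by (rule card_mono[OF finite_rep]) (use assms in auto)
  ultimately show False
    using assms(1)[of "x + y + d"] by simp
qed

lemma card_equal_differences:
  assumes "\<And>n. rep B n \<le> 3" and "0 < d"
  shows "finite {x \<in> B. x + d \<in> B} \<and> card {x \<in> B. x + d \<in> B} \<le> 2"
proof (cases "{x \<in> B. x + d \<in> B} = {}")
  case False
  let ?S = "{x \<in> B. x + d \<in> B}"
  define x where "x = (LEAST x. x \<in> ?S)"
  have x: "x \<in> ?S"
    unfolding x_def by (rule LeastI_ex) (use False in blast)
  have "?S \<subseteq> {x, x + d}"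
  proof
    fix y assume y: "y \<in> ?S"
    then have "x \<le> y"
      unfolding x_def by (rule Least_le)
    then show "y \<in> {x, x + d}"
      using equal_differences_overlap[OF assms(1), of x d y] x y assms(2)
      by (cases "x = y") auto
  qed
  moreover have "card {x, x + d} \<le> 2"
    by (simp add: card_insert_if)
  ultimately show ?thesis
    by (meson card_mono finite.emptyI finite.insertI finite_subset le_trans)
next
  case True
  show ?thesis by (simp only: True) simp
qed

section \<open>Squares of the block counts\<close>

text \<open>With \<open>p\<close> increasing pairs, \<open>k\<^sup>2 = 2 * p + k\<close> for \<open>k = card S\<close>; the term \<open>k\<close> is absorbed by
  \<open>(k - 1)\<^sup>2 \<ge> 0\<close>.\<close>

lemma card_square_le_pairs:
  fixes S :: "nat set"
  assumes "finite S"
  shows "(card S)\<^sup>2 \<le> 4 * card {(x, y) \<in> S \<times> S. x < y} + 1"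
proof -
  let ?P = "{(x, y) \<in> S \<times> S. x < y}" and ?Q = "{(x, y) \<in> S \<times> S. y < x}"
  let ?I = "(\<lambda>x. (x, x)) ` S"
  have fin: "finite ?P" "finite ?Q" "finite ?I"
    by (rule finite_subset[of _ "S \<times> S"]; use assms in auto)+
  have "?Q = prod.swap ` ?P" by auto
  then have Q: "card ?Q = card ?P"
    by (simp add: card_image)
  have I: "card ?I = card S"
    by (rule card_image) (simp add: inj_on_def)
  have "S \<times> S = (?P \<union> ?Q) \<union> ?I" by auto
  then have "card (S \<times> S) = card ((?P \<union> ?Q) \<union> ?I)" by (rule arg_cong)
  also have "\<dots> = card (?P \<union> ?Q) + card ?I"
    by (rule card_Un_disjoint) (use fin in auto)
  also have "card (?P \<union> ?Q) = card ?P + card ?Q"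
    by (rule card_Un_disjoint) (use fin in auto)
  finally have "(card S)\<^sup>2 = 2 * card ?P + card S"
    using Q I by (simp add: card_cartesian_product power2_eq_square)
  moreover have "2 * card S \<le> (card S)\<^sup>2 + 1"
    using sum_squares_bound[of "real (card S)" 1] of_nat_le_iff[where ?'a = real, of "2 * card S" "(card S)\<^sup>2 + 1"]
    by simp
  ultimately show ?thesis by linarith
qed

text \<open>An increasing pair in a block is determined by its smaller element and its difference; the
  difference lies in \<open>{1..<N}\<close> and belongs to at most two pairs of \<open>B\<close>, in whatever blocks.\<close>

lemma sum_block_squares:
  assumes "\<And>n. rep B n \<le> 3" and "0 < N"
  shows "(\<Sum>l<N. (card (B \<inter> {l * N..<Suc l * N}))\<^sup>2) \<le> 9 * N"
proof -
  define S where "S l = B \<inter> {l * N..<Suc l * N}" for l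
  define P where "P l = {(x, y) \<in> S l \<times> S l. x < y}" for l
  have finS: "finite (S l)" for l by (simp add: S_def)
  have finP: "finite (P l)" for l
    by (rule finite_subset[of _ "S l \<times> S l"]) (use finS in \<open>auto simp: P_def\<close>)
  have S_div: "x div N = l" if "x \<in> S l" for x l
    using that assms(2) by (intro div_nat_eqI) (auto simp: S_def algebra_simps)
  have S_disjoint: "l = j" if "x \<in> S l" "x \<in> S j" for x l j
    using S_div[OF that(1)] S_div[OF that(2)] by simp
  let ?T = "SIGMA d:{1..<N}. {x \<in> B. x + d \<in> B}"
  let ?f = "\<lambda>(x, y). (y - x, x)"
  have T: "finite ?T"
    using card_equal_differences[OF assms(1)] by (intro finite_SigmaI) auto
  have "(\<Sum>l<N. card (P l)) = card (\<Union>l<N. P l)"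
    using finP by (intro card_UN_disjoint[symmetric]) (auto simp: P_def dest: S_disjoint)
  also have "\<dots> \<le> card ?T"
  proof (rule card_inj_on_le[of ?f])
    show "inj_on ?f (\<Union>l<N. P l)"
      by (auto simp: inj_on_def P_def)
    show "?f ` (\<Union>l<N. P l) \<subseteq> ?T"
      by (auto simp: P_def S_def)
  qed (rule T)
  also have "\<dots> = (\<Sum>d\<in>{1..<N}. card {x \<in> B. x + d \<in> B})"
    using card_equal_differences[OF assms(1)] by (intro card_SigmaI) auto
  also have "\<dots> \<le> (\<Sum>d\<in>{1..<N}. 2)"
    using card_equal_differences[OF assms(1)] by (intro sum_mono) auto
  also have "\<dots> \<le> 2 * N" by simp
  finally have pairs: "(\<Sum>l<N. card (P l)) \<le> 2 * N" .
  have "(\<Sum>l<N. (card (S l))\<^sup>2) \<le> (\<Sum>l<N. 4 * card (P l) + 1)"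
    unfolding P_def by (intro sum_mono card_square_le_pairs finS)
  also have "\<dots> = 4 * (\<Sum>l<N. card (P l)) + N"
    unfolding sum.distrib sum_distrib_left by simp
  finally show ?thesis
    using pairs by (simp add: S_def)
qed

section \<open>The weighted sum of the block counts\<close>

lemma inverse_sqrt_decrement:
  "1 / (2 * sqrt (real (l + 1)) * real (l + 2)) \<le> 1 / sqrt (real (l + 1)) - 1 / sqrt (real (l + 2))"
proof -
  define a where "a = sqrt (real (l + 1))"
  define b where "b = sqrt (real (l + 2))"
  have a: "a > 0" and ab: "a \<le> b" and b2: "b * b = real (l + 2)"
    and diff: "(b - a) * (b + a) = 1"
    by (auto simp: a_def b_def algebra_simps)
  have "1 / (2 * a * (b * b)) \<le> 1 / (a * b * (b + a))"
    using a ab by (intro divide_left_mono) (auto simp: algebra_simps intro!: mult_pos_pos add_pos_pos)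
  also have "\<dots> = (b - a) * (b + a) / (a * b * (b + a))" by (simp add: diff)
  also have "\<dots> = (b - a) / (a * b)"
    using a ab by simp
  also have "\<dots> = 1 / a - 1 / b"
    using a ab by (simp add: field_simps)
  finally show ?thesis
    unfolding b2 by (simp add: a_def b_def)
qed

text \<open>Partial summation: the partial sums of \<open>D\<close> grow like a square root, so against the weights
  \<open>1 / sqrt (l + 1)\<close> every index \<open>l > 0\<close> contributes at least a constant times \<open>1 / l\<close>.\<close>

lemma weighted_sum_lower_bound:
  fixes D :: "nat \<Rightarrow> real"
  assumes "0 \<le> c" and growth: "\<And>l. c * sqrt (real l) \<le> (\<Sum>k<l. D k)"
  shows "c / 2 * (harm (Suc n) - 1) \<le> (\<Sum>l<n. D l / sqrt (real (l + 1)))"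
proof -
  define s where "s l = (\<Sum>k<l. D k)" for l
  define w where "w l = 1 / sqrt (real (l + 1))" for l
  have abel: "(\<Sum>l<n. D l * w l) = s n * w n + (\<Sum>l<n. s (Suc l) * (w l - w (Suc l)))"
    by (induction n) (simp_all add: s_def algebra_simps)
  have "c / 2 * (harm (Suc n) - 1) = (\<Sum>l<n. c / 2 * (1 / real (l + 2)))"
  proof (induction n)
    case 0
    show ?case by (simp add: harm_expand)
  next
    case (Suc n)
    then show ?case
      by (simp add: harm_Suc[of "Suc n"] inverse_eq_divide distrib_left algebra_simps)
  qed
  also have "\<dots> \<le> (\<Sum>l<n. s (Suc l) * (w l - w (Suc l)))"
  proof (rule sum_mono)
    fix l
    have "c / 2 * (1 / real (l + 2)) =
        c * sqrt (real (l + 1)) * (1 / (2 * sqrt (real (l + 1)) * real (l + 2)))"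
      by simp
    also have "\<dots> \<le> c * sqrt (real (l + 1)) * (w l - w (Suc l))"
      using assms(1) inverse_sqrt_decrement[of l]
      by (intro mult_left_mono) (simp_all add: w_def)
    also have "\<dots> \<le> s (Suc l) * (w l - w (Suc l))"
      using growth[of "Suc l"]
      by (intro mult_right_mono) (simp_all add: s_def w_def frac_le)
    finally show "c / 2 * (1 / real (l + 2)) \<le> s (Suc l) * (w l - w (Suc l))" .
  qed
  also have "\<dots> \<le> (\<Sum>l<n. D l * w l)"
  proof -
    have "0 \<le> c * sqrt (real n)" using assms(1) by simp
    then have "0 \<le> s n" using growth[of n] by (simp add: s_def)
    then have "0 \<le> s n * w n" by (simp add: w_def)
    then show ?thesis using abel by linarith
  qed
  finally show ?thesis by (simp add: w_def)
qed

section \<open>Thinness along a subsequence\<close>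

lemma card_below_blocks:
  "card (B \<inter> {..<l * N}) = (\<Sum>k<l. card (B \<inter> {k * N..<Suc k * (N::nat)}))"
proof (induction l)
  case (Suc l)
  have "B \<inter> {..<Suc l * N} = (B \<inter> {..<l * N}) \<union> (B \<inter> {l * N..<Suc l * N})"
    by auto
  then have "card (B \<inter> {..<Suc l * N}) =
      card ((B \<inter> {..<l * N}) \<union> (B \<inter> {l * N..<Suc l * N}))"
    by (rule arg_cong)
  also have "\<dots> = card (B \<inter> {..<l * N}) + card (B \<inter> {l * N..<Suc l * N})"
    by (rule card_Un_disjoint) auto
  finally show ?case using Suc by simp
qed simp

text \<open>For block length \<open>N\<close> and \<open>N\<close> blocks, with \<open>h = harm (Suc N)\<close>, the lower bound for the weighted
  sum is of order \<open>sqrt N * h\<close> and the Cauchy-Schwarz upper bound of order \<open>sqrt (N * h)\<close>, so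
  \<open>h\<close> would stay bounded.\<close>

lemma rep_le_3_not_dense:
  assumes rep: "\<And>n. rep B n \<le> 3" and "0 < c"
    and dense: "\<forall>\<^sub>F n in sequentially. c * sqrt (real n) \<le> real (card (B \<inter> {..<n}))"
  shows False
proof -
  obtain n0 where n0: "\<And>n. n \<ge> n0 \<Longrightarrow> c * sqrt (real n) \<le> real (card (B \<inter> {..<n}))"
    using dense unfolding eventually_sequentially by blast
  have bound: "c\<^sup>2 / 4 * (harm (Suc N) - 1)\<^sup>2 \<le> 9 * harm (Suc N)" if N: "N \<ge> Suc n0" for N
  proof -
    define D where "D l = real (card (B \<inter> {l * N..<Suc l * N}))" for l
    let ?w = "\<lambda>l. 1 / sqrt (real (l + 1))"
    have growth: "c * sqrt (real N) * sqrt (real l) \<le> (\<Sum>k<l. D k)" for l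
    proof (cases l)
      case (Suc k)
      then have "l * N \<ge> n0" using N by simp
      from n0[OF this] show ?thesis
        unfolding card_below_blocks by (simp add: D_def real_sqrt_mult mult_ac)
    qed simp
    have harm_w: "(\<Sum>l<n. (?w l)\<^sup>2) = harm n" for n
      by (induction n) (simp_all add: harm_expand harm_Suc power_divide inverse_eq_divide)
    have "1 \<le> (harm (Suc N) :: real)"
      using harm_mono[of "Suc 0" "Suc N", where ?'a = real] by (simp add: harm_expand)
    then have "(c * sqrt (real N) / 2 * (harm (Suc N) - 1))\<^sup>2 \<le> (\<Sum>l<N. D l * ?w l)\<^sup>2"
      using weighted_sum_lower_bound[OF _ growth, of N] \<open>0 < c\<close>
      by (intro power_mono) simp_all
    also have "\<dots> \<le> (\<Sum>l<N. (D l)\<^sup>2) * (\<Sum>l<N. (?w l)\<^sup>2)"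
      by (rule Cauchy_Schwarz_ineq_sum)
    also have "\<dots> \<le> (9 * real N) * harm (Suc N)"
    proof (rule mult_mono)
      have "real (\<Sum>l<N. (card (B \<inter> {l * N..<Suc l * N}))\<^sup>2) \<le> real (9 * N)"
        using sum_block_squares[OF rep, of N] N by (simp only: of_nat_le_iff)
      then show "(\<Sum>l<N. (D l)\<^sup>2) \<le> 9 * real N"
        by (simp add: D_def)
      show "(\<Sum>l<N. (?w l)\<^sup>2) \<le> harm (Suc N)"
        unfolding harm_w by (rule harm_mono) simp
    qed (simp_all add: sum_nonneg)
    finally have "real N * (c\<^sup>2 / 4 * (harm (Suc N) - 1)\<^sup>2) \<le> real N * (9 * harm (Suc N))"
      by (simp add: power_mult_distrib power_divide mult_ac)
    then show ?thesis using N by (simp only: mult_le_cancel_left_pos of_nat_0_less_iff)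
  qed
  have lim: "filterlim (\<lambda>N. harm (Suc N) :: real) at_top sequentially"
  proof (rule filterlim_at_top_mono)
    show "filterlim (\<lambda>N. ln (real N)) at_top sequentially"
      by (rule filterlim_compose[OF ln_at_top filterlim_real_sequentially])
    show "\<forall>\<^sub>F N in sequentially. ln (real N) \<le> harm (Suc N)"
    proof (rule eventually_sequentiallyI)
      fix N :: nat assume "1 \<le> N"
      then have "ln (real N) \<le> ln (real (Suc N) + 1)" by simp
      also have "\<dots> \<le> harm (Suc N)" by (rule ln_le_harm)
      finally show "ln (real N) \<le> harm (Suc N)" .
    qed
  qed
  \<comment> \<open>For \<open>h \<ge> 2\<close> one has \<open>h \<le> 2 * (h - 1)\<close>, so \<open>bound\<close> forces \<open>h - 1 \<le> 72 / c\<^sup>2\<close>.\<close>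
  obtain N where N: "N \<ge> Suc n0" and h: "harm (Suc N) \<ge> 72 / c\<^sup>2 + 2"
    using eventually_conj[OF eventually_ge_at_top[of "Suc n0"]
        filterlim_at_top[THEN iffD1, OF lim, rule_format, of "72 / c\<^sup>2 + 2"]]
    unfolding eventually_sequentially by blast
  define g :: real where "g = harm (Suc N) - 1"
  have "0 < c\<^sup>2" using \<open>0 < c\<close> by simp
  then have "72 / c\<^sup>2 > 0" by simp
  then have g: "g \<ge> 1" "g > 72 / c\<^sup>2" using h unfolding g_def by linarith+
  have "c\<^sup>2 / 4 * g * g \<le> 9 * (g + 1)"
    using bound[OF N] by (simp add: g_def power2_eq_square mult_ac)
  also have "\<dots> \<le> 18 * g" using g by simp
  finally have "c\<^sup>2 / 4 * g \<le> 18" using g by simp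
  moreover have "72 < g * c\<^sup>2" using g(2) \<open>0 < c\<^sup>2\<close> by (simp add: pos_divide_less_eq)
  ultimately show False by (simp add: mult_ac)
qed

section \<open>Sumsets of positive lower density\<close>

text \<open>As \<open>A\<close> has no element \<open>0\<close>, both summands of a number in \<open>{1..n}\<close> lie below \<open>n\<close>.\<close>

lemma card_sumset_le_square:
  fixes A :: "nat set"
  assumes "A \<subseteq> {1..}"
  shows "card ((A + A) \<inter> {1..n}) \<le> (card (A \<inter> {..<n}))\<^sup>2"
proof -
  let ?X = "A \<inter> {..<n}"
  have "(A + A) \<inter> {1..n} \<subseteq> (\<lambda>(a, b). a + b) ` (?X \<times> ?X)"
  proof
    fix s assume "s \<in> (A + A) \<inter> {1..n}"
    then obtain a b where ab: "s = a + b" "a \<in> A" "b \<in> A" "a + b \<le> n"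
      by (auto elim!: set_plus_elim)
    moreover have "1 \<le> a" "1 \<le> b" using ab assms by auto
    ultimately show "s \<in> (\<lambda>(a, b). a + b) ` (?X \<times> ?X)"
      by (intro image_eqI[of _ _ "(a, b)"]) auto
  qed
  then have "card ((A + A) \<inter> {1..n}) \<le> card ((\<lambda>(a, b). a + b) ` (?X \<times> ?X))"
    by (intro card_mono) auto
  also have "\<dots> \<le> card (?X \<times> ?X)" by (rule card_image_le) simp
  finally show ?thesis by (simp add: card_cartesian_product power2_eq_square)
qed

lemma sqrt_growth_of_sumset_density:
  fixes A :: "nat set"
  assumes "A \<subseteq> {1..}" and "upper_density ({1..} - (A + A)) < 1"
  obtains c where "0 < c" "\<forall>\<^sub>F n in sequentially. c * sqrt (real n) \<le> real (card (A \<inter> {..<n}))"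
proof -
  let ?E = "{1..} - (A + A)"
  obtain q where q: "upper_density ?E < ereal q" "ereal q < 1"
    using ereal_dense2[OF assms(2)] by blast
  have "\<forall>\<^sub>F n in sequentially. ereal (real (card (?E \<inter> {1..n})) / real n) < ereal q"
    using q(1) unfolding upper_density_def by (rule Limsup_lessD)
  then have "\<forall>\<^sub>F n in sequentially. sqrt (1 - q) * sqrt (real n) \<le> real (card (A \<inter> {..<n}))"
    using eventually_gt_at_top[of 0]
  proof eventually_elim
    case (elim n)
    then have E: "real (card (?E \<inter> {1..n})) \<le> q * real n"
      by (simp add: pos_divide_less_eq)
    have "{1..n} = (?E \<inter> {1..n}) \<union> ((A + A) \<inter> {1..n})" by auto
    then have "card {1..n} \<le> card (?E \<inter> {1..n}) + card ((A + A) \<inter> {1..n})"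
      by (metis card_Un_le)
    then have "real n \<le> real (card (?E \<inter> {1..n})) + real (card ((A + A) \<inter> {1..n}))"
      by simp
    moreover have "real (card ((A + A) \<inter> {1..n})) \<le> (real (card (A \<inter> {..<n})))\<^sup>2"
      using card_sumset_le_square[OF assms(1), of n]
      by (metis of_nat_le_iff of_nat_power)
    ultimately have "(1 - q) * real n \<le> (real (card (A \<inter> {..<n})))\<^sup>2"
      using E unfolding left_diff_distrib mult_1 by linarith
    then have "sqrt ((1 - q) * real n) \<le> real (card (A \<inter> {..<n}))"
      by (rule real_le_lsqrt[rotated]) simp
    then show ?case by (simp add: real_sqrt_mult)
  qed
  moreover have "0 < sqrt (1 - q)" using q(2) by (simp add: one_ereal_def)
  ultimately show thesis using that by blast
qed

text \<open>If \<open>rep A n \<le> 3\<close> for \<open>n \<ge> m\<close>, discarding the elements of \<open>A\<close> below \<open>m\<close> makes the bound hold for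
  all \<open>n\<close>, as smaller numbers are no longer sums. The loss of at most \<open>m\<close> elements costs only a
  factor \<open>2\<close> in the square root growth.\<close>

theorem limsup_rep_gt_3_if_upper_density_less_1:
  fixes A :: "nat set"
  assumes "A \<subseteq> {1..}" and "upper_density ({1..} - (A + A)) < 1"
  shows "limsup (\<lambda>n. enat (rep A n)) > 3"
proof (rule ccontr)
  assume "\<not> limsup (\<lambda>n. enat (rep A n)) > 3"
  then have "limsup (\<lambda>n. enat (rep A n)) \<le> 3" by (simp only: not_less)
  also have "(3 :: enat) < 4" by simp
  finally have "limsup (\<lambda>n. enat (rep A n)) < 4" .
  then have "\<forall>\<^sub>F n in sequentially. enat (rep A n) < 4"
    by (rule Limsup_lessD)
  then obtain m where m: "\<And>n. n \<ge> m \<Longrightarrow> rep A n \<le> 3"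
    unfolding eventually_sequentially by (force simp: numeral_eq_enat)
  define B where "B = A \<inter> {m..}"
  have rep_B: "rep B n \<le> 3" for n
  proof (cases "m \<le> n")
    case True
    then show ?thesis
      using m[of n] rep_mono[of B A n] by (auto simp: B_def)
  next
    case False
    then have "{(a, b) \<in> B \<times> B. a + b = n} = {}" by (auto simp: B_def)
    then show ?thesis by (simp add: rep_def del: Collect_empty_eq)
  qed
  obtain c where "0 < c"
    and c: "\<forall>\<^sub>F n in sequentially. c * sqrt (real n) \<le> real (card (A \<inter> {..<n}))"
    using sqrt_growth_of_sumset_density[OF assms] by blast
  have "filterlim (\<lambda>n. c / 2 * sqrt (real n)) at_top sequentially"
    using \<open>0 < c\<close>
    by (intro filterlim_tendsto_pos_mult_at_top[OF tendsto_const]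
        filterlim_compose[OF sqrt_at_top filterlim_real_sequentially]) simp
  then have "\<forall>\<^sub>F n in sequentially. real m \<le> c / 2 * sqrt (real n)"
    by (simp add: filterlim_at_top)
  with c have "\<forall>\<^sub>F n in sequentially. c / 2 * sqrt (real n) \<le> real (card (B \<inter> {..<n}))"
  proof eventually_elim
    case (elim n)
    have "A \<inter> {..<n} \<subseteq> (B \<inter> {..<n}) \<union> {..<m}" by (auto simp: B_def)
    then have "card (A \<inter> {..<n}) \<le> card ((B \<inter> {..<n}) \<union> {..<m})"
      by (intro card_mono) auto
    also have "\<dots> \<le> card (B \<inter> {..<n}) + card {..<m}" by (rule card_Un_le)
    finally have "real (card (A \<inter> {..<n})) \<le> real (card (B \<inter> {..<n})) + real m" by simp
    with elim show ?case by (simp add: field_simps)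
  qed
  then show False
    using rep_le_3_not_dense[OF rep_B, of "c / 2"] \<open>0 < c\<close> by simp
qed

theorem theorem2:
  fixes A E :: "nat set"
  assumes "A \<subseteq> {1..}"
    and "E = {1..} - (A + A)"
    and "upper_density E < ereal (1 / 2)"
  shows "limsup (\<lambda>n. enat (rep A n)) > 3"
proof (rule limsup_rep_gt_3_if_upper_density_less_1[OF assms(1)])
  have "upper_density E < ereal 1"
    using assms(3) by (rule less_trans) simp
  then show "upper_density ({1..} - (A + A)) < 1"
    by (simp add: assms(2) one_ereal_def)
qed

end
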